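(* There is an algorithm which, given a social network $(G,P,p,\theta)$ with $n$ nodes and a product $top\in P$, determines in time $O(n^2)$ whether the social network $(G,P,[top],\theta)$ is unavoidable from $(G,P,p,\theta)$, where $[top]$ denotes the constant function assigning $\{top\}$ to every node of $G$.
   Context: Setting. $G=(V,E)$ is a finite weighted directed graph with no parallel edges and no self-loops, $n=|V|$, and each edge $(i,j)$ has a weight $w_{ij}\in[0,1]$. For a node $i$, $N(i)$ is the set of nodes $j$ with an edge $(j,i)\in E$ (the neighbours of $i$). It is assumed that $\sum_{j\in N(i)} w_{ji}\le 1$ for every node $i$ with $N(i)\ne\emptyset$. The threshold function $\theta$ assigns to each node $i$ a value $\theta(i)\in(0,1]$. $P$ is a finite set of products. A social network is a tuple $(G,P,p,\theta)$ where $p$ assigns to each node a non-empty subset of $P$; since $G,P,\theta$ are fixed, a social network is identified with $p$. Reductions. For a product $t$ and a node $i$, the adoption condition $A(t,i)$ holds in $p$ if $N(i)=\emptyset$, or if $N(i)\neq\emptyset$ and $\sum_{j\in N(i)\mid p(j)=\{t\}} w_{ji}\ge\theta(i)$. Write $p_1\to p_2$ if $p_2\ne p_1$ and for all nodes $i$ with $p_2(i)\ne p_1(i)$ we have $|p_1(i)|\ge 2$ and, for some $t\in p_1(i)$, $p_2(i)=\{t\}$ and $A(t,i)$ holds in $p_1$. Let $\to^*$ be the reflexive, transitive closure of $\to$. A reduction sequence $p\to^* p'$ is maximal if there is no $p''$ with $p'\to p''$. A network $p'$ is unavoidable from $p$ if for all maximal reduction sequences $p\to^* p''$ we have $p'=p''$.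 *)

theory Defs
  imports
    "Graph_Theory.Pair_Digraph"
    "HOL-Library.FuncSet"
    "HOL-Library.Landau_Symbols"
begin

section \<open>Social networks and their reductions\<close>

definition neighbours :: "'v pair_pre_digraph \<Rightarrow> 'v \<Rightarrow> 'v set" where
  "neighbours G i = {j. (j, i) \<in> parcs G}"

text \<open>
  Product assignments are extensional, so that HOL equality is equality of functions on the nodes.
\<close>

definition assignments :: "'v pair_pre_digraph \<Rightarrow> 'a set \<Rightarrow> ('v \<Rightarrow> 'a set) set" where
  "assignments G P = pverts G \<rightarrow>\<^sub>E (Pow P - {{}})"

definition const_assignment :: "'v pair_pre_digraph \<Rightarrow> 'a \<Rightarrow> ('v \<Rightarrow> 'a set)" where
  "const_assignment G t = (\<lambda>i\<in>pverts G. {t})"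

text \<open>
  The weights \<open>w\<close> matter only on arcs, and the thresholds \<open>\<theta>\<close> only on nodes.
\<close>

definition social_network ::
  "'v pair_pre_digraph \<Rightarrow> ('v \<Rightarrow> 'v \<Rightarrow> real) \<Rightarrow> 'a set \<Rightarrow> ('v \<Rightarrow> real) \<Rightarrow> ('v \<Rightarrow> 'a set) \<Rightarrow> bool"
where
  "social_network G w P \<theta> p \<longleftrightarrow>
     pair_digraph G \<and> finite P \<and>
     (\<forall>(i, j)\<in>parcs G. 0 \<le> w i j \<and> w i j \<le> 1) \<and>
     (\<forall>i\<in>pverts G. neighbours G i \<noteq> {} \<longrightarrow> (\<Sum>j\<in>neighbours G i. w j i) \<le> 1) \<and>
     (\<forall>i\<in>pverts G. 0 < \<theta> i \<and> \<theta> i \<le> 1) \<and>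
     p \<in> assignments G P"

definition adoption_condition ::
  "'v pair_pre_digraph \<Rightarrow> ('v \<Rightarrow> 'v \<Rightarrow> real) \<Rightarrow> ('v \<Rightarrow> real) \<Rightarrow> ('v \<Rightarrow> 'a set) \<Rightarrow> 'a \<Rightarrow> 'v \<Rightarrow> bool"
where
  "adoption_condition G w \<theta> p t i \<longleftrightarrow>
     neighbours G i = {} \<or>
     (neighbours G i \<noteq> {} \<and> (\<Sum>j\<in>{j \<in> neighbours G i. p j = {t}}. w j i) \<ge> \<theta> i)"

definition reduces ::
  "'v pair_pre_digraph \<Rightarrow> ('v \<Rightarrow> 'v \<Rightarrow> real) \<Rightarrow> 'a set \<Rightarrow> ('v \<Rightarrow> real) \<Rightarrow>
   ('v \<Rightarrow> 'a set) \<Rightarrow> ('v \<Rightarrow> 'a set) \<Rightarrow> bool"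
where
  "reduces G w P \<theta> p1 p2 \<longleftrightarrow>
     p1 \<in> assignments G P \<and> p2 \<in> assignments G P \<and> p2 \<noteq> p1 \<and>
     (\<forall>i\<in>pverts G. p2 i \<noteq> p1 i \<longrightarrow>
        card (p1 i) \<ge> 2 \<and> (\<exists>t\<in>p1 i. p2 i = {t} \<and> adoption_condition G w \<theta> p1 t i))"

definition unavoidable ::
  "'v pair_pre_digraph \<Rightarrow> ('v \<Rightarrow> 'v \<Rightarrow> real) \<Rightarrow> 'a set \<Rightarrow> ('v \<Rightarrow> real) \<Rightarrow>
   ('v \<Rightarrow> 'a set) \<Rightarrow> ('v \<Rightarrow> 'a set) \<Rightarrow> bool"
where
  "unavoidable G w P \<theta> p p' \<longleftrightarrow>
     (\<forall>p''. (reduces G w P \<theta>)\<^sup>*\<^sup>* p p'' \<and> \<not> (\<exists>q. reduces G w P \<theta> p'' q) \<longrightarrow> p' = p'')"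

section \<open>Algorithms: programs of a unit-cost real RAM\<close>

text \<open>
  The model of computation is a while language over natural numbers and exact reals, with
  random-access arrays. The only arithmetic is addition and (on \<open>nat\<close>, truncated) subtraction, so
  that natural numbers grow by at most a constant number of bits per step. Real values can be
  compared, but not converted to natural numbers. Arrays have two indices, so that no multiplication is
  needed for addressing. A program is a finite object whose only constants are natural numbers
  and integers.
\<close>

type_synonym name = string

record state =
  nvar :: "name \<Rightarrow> nat"
  narr :: "name \<Rightarrow> nat \<Rightarrow> nat \<Rightarrow> nat"
  rvar :: "name \<Rightarrow> real"
  rarr :: "name \<Rightarrow> nat \<Rightarrow> nat \<Rightarrow> real"

datatype nexp =
    NConst nat | NVar name | NArr name nexp nexp | NAdd nexp nexp | NSub nexp nexp

datatype rexp =
    RConst int | RVar name | RArr name nexp nexp | RAdd rexp rexp | RSub rexp rexp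

datatype bexp =
    NLess nexp nexp | RLess rexp rexp | BNot bexp | BAnd bexp bexp

datatype com =
    Skip
  | NAssign name nexp
  | NStore name nexp nexp nexp
  | RAssign name rexp
  | RStore name nexp nexp rexp
  | Seq com com
  | Cond bexp com com
  | While bexp com

primrec nval :: "nexp \<Rightarrow> state \<Rightarrow> nat" where
  "nval (NConst c) s = c"
| "nval (NVar x) s = nvar s x"
| "nval (NArr a e1 e2) s = narr s a (nval e1 s) (nval e2 s)"
| "nval (NAdd e1 e2) s = nval e1 s + nval e2 s"
| "nval (NSub e1 e2) s = nval e1 s - nval e2 s"

primrec rval :: "rexp \<Rightarrow> state \<Rightarrow> real" where
  "rval (RConst c) s = of_int c"
| "rval (RVar x) s = rvar s x"
| "rval (RArr a e1 e2) s = rarr s a (nval e1 s) (nval e2 s)"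
| "rval (RAdd e1 e2) s = rval e1 s + rval e2 s"
| "rval (RSub e1 e2) s = rval e1 s - rval e2 s"

primrec bval :: "bexp \<Rightarrow> state \<Rightarrow> bool" where
  "bval (NLess e1 e2) s \<longleftrightarrow> nval e1 s < nval e2 s"
| "bval (RLess e1 e2) s \<longleftrightarrow> rval e1 s < rval e2 s"
| "bval (BNot b) s \<longleftrightarrow> \<not> bval b s"
| "bval (BAnd b1 b2) s \<longleftrightarrow> bval b1 s \<and> bval b2 s"

definition store2 :: "(name \<Rightarrow> nat \<Rightarrow> nat \<Rightarrow> 'b) \<Rightarrow> name \<Rightarrow> nat \<Rightarrow> nat \<Rightarrow> 'b \<Rightarrow> (name \<Rightarrow> nat \<Rightarrow> nat \<Rightarrow> 'b)"
where
  "store2 m a i j v = m(a := (m a)(i := (m a i)(j := v)))"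

text \<open>
  \<open>exec c s t s'\<close>: started in state \<open>s\<close>, the program \<open>c\<close> terminates after exactly \<open>t\<close> steps in state
  \<open>s'\<close>. Every elementary command and every test counts as one step; since a program contains only
  finitely many expressions, charging for their evaluation would change \<open>t\<close> by at most a constant
  factor depending on the program.
\<close>

inductive exec :: "com \<Rightarrow> state \<Rightarrow> nat \<Rightarrow> state \<Rightarrow> bool" where
  Skip: "exec Skip s 1 s"
| NAssign: "exec (NAssign x e) s 1 (s\<lparr>nvar := (nvar s)(x := nval e s)\<rparr>)"
| NStore: "exec (NStore a e1 e2 e) s 1
             (s\<lparr>narr := store2 (narr s) a (nval e1 s) (nval e2 s) (nval e s)\<rparr>)"
| RAssign: "exec (RAssign x e) s 1 (s\<lparr>rvar := (rvar s)(x := rval e s)\<rparr>)"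
| RStore: "exec (RStore a e1 e2 e) s 1
             (s\<lparr>rarr := store2 (rarr s) a (nval e1 s) (nval e2 s) (rval e s)\<rparr>)"
| Seq: "exec c1 s t1 s1 \<Longrightarrow> exec c2 s1 t2 s2 \<Longrightarrow> exec (Seq c1 c2) s (t1 + t2) s2"
| CondTrue: "bval b s \<Longrightarrow> exec c1 s t s' \<Longrightarrow> exec (Cond b c1 c2) s (Suc t) s'"
| CondFalse: "\<not> bval b s \<Longrightarrow> exec c2 s t s' \<Longrightarrow> exec (Cond b c1 c2) s (Suc t) s'"
| WhileFalse: "\<not> bval b s \<Longrightarrow> exec (While b c) s 1 s"
| WhileTrue: "bval b s \<Longrightarrow> exec c s t1 s1 \<Longrightarrow> exec (While b c) s1 t2 s2 \<Longrightarrow>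
              exec (While b c) s (Suc (t1 + t2)) s2"

inductive_cases exec_SkipE: "exec Skip s t s'"
inductive_cases exec_NAssignE: "exec (NAssign x e) s t s'"
inductive_cases exec_NStoreE: "exec (NStore a e1 e2 e) s t s'"
inductive_cases exec_RAssignE: "exec (RAssign x e) s t s'"
inductive_cases exec_RStoreE: "exec (RStore a e1 e2 e) s t s'"
inductive_cases exec_SeqE: "exec (Seq c1 c2) s t s'"
inductive_cases exec_CondE: "exec (Cond b c1 c2) s t s'"
inductive_cases exec_WhileE: "exec (While b c) s t s'"

text \<open>
  Execution is deterministic, hence the existence of a terminating execution with some property
  says that the unique execution has that property.
\<close>

lemma exec_deterministic:
  "exec c s t s' \<Longrightarrow> exec c s u s'' \<Longrightarrow> t = u \<and> s' = s''"
proof (induction arbitrary: u s'' rule: exec.induct)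
  case (Seq c1 s t1 s1 c2 t2 s2)
  from Seq.prems show ?case by (rule exec_SeqE) (use Seq.IH in blast)
next
  case (CondTrue b s c1 t s' c2)
  from CondTrue.prems show ?case by (rule exec_CondE) (use CondTrue in blast)+
next
  case (CondFalse b s c2 t s' c1)
  from CondFalse.prems show ?case by (rule exec_CondE) (use CondFalse in blast)+
next
  case (WhileTrue b s c t1 s1 t2 s2)
  from WhileTrue.prems show ?case by (rule exec_WhileE) (use WhileTrue in blast)+
next
  case (WhileFalse b s c)
  from WhileFalse.prems show ?case by (rule exec_WhileE) (use WhileFalse in auto)
qed (auto elim: exec_SkipE exec_NAssignE exec_NStoreE exec_RAssignE exec_RStoreE)

section \<open>Presentation of a social network to a program\<close>

definition enumerates :: "'b list \<Rightarrow> 'b set \<Rightarrow> bool" where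
  "enumerates xs A \<longleftrightarrow> distinct xs \<and> set xs = A"

text \<open>
  Relative to enumerations \<open>vs\<close> of the nodes and \<open>ps\<close> of the products, the graph is given by its
  adjacency and weight matrices, and the thresholds by an array. Adjacency is given separately,
  because arcs may have weight \<open>0\<close>. Each set \<open>p(i)\<close> is given by its membership table together with
  its cardinality: without the latter, testing whether \<open>p(i)\<close> is a singleton would require reading
  the whole table, i.e. time depending on \<open>|P|\<close>. The product in question is given by its index \<open>k\<close>
  in \<open>ps\<close>. All other memory cells contain \<open>0\<close>.
\<close>

definition encode ::
  "'v pair_pre_digraph \<Rightarrow> ('v \<Rightarrow> 'v \<Rightarrow> real) \<Rightarrow> ('v \<Rightarrow> real) \<Rightarrow> ('v \<Rightarrow> 'a set) \<Rightarrow>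
   'v list \<Rightarrow> 'a list \<Rightarrow> nat \<Rightarrow> state"
where
  "encode G w \<theta> p vs ps k =
    \<lparr> nvar = (\<lambda>_. 0)(''n'' := length vs, ''m'' := length ps, ''top'' := k),
      narr = (\<lambda>_ _ _. 0)
        (''edge'' := (\<lambda>i j. if i < length vs \<and> j < length vs
                             then of_bool ((vs ! i, vs ! j) \<in> parcs G) else 0),
         ''member'' := (\<lambda>i l. if i < length vs \<and> l < length ps
                               then of_bool (ps ! l \<in> p (vs ! i)) else 0),
         ''card'' := (\<lambda>i j. if i < length vs \<and> j = 0 then card (p (vs ! i)) else 0)),
      rvar = (\<lambda>_. 0),
      rarr = (\<lambda>_ _ _. 0)
        (''weight'' := (\<lambda>i j. if i < length vs \<and> j < length vs \<and> (vs ! i, vs ! j) \<in> parcs G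
                               then w (vs ! i) (vs ! j) else 0),
         ''threshold'' := (\<lambda>i j. if i < length vs \<and> j = 0 then \<theta> (vs ! i) else 0)) \<rparr>"

end

theory Submission
  imports Defs
begin

text \<open>
  If \<open>tp \<notin> p(i)\<close> for some node \<open>i\<close>, then \<open>i\<close> never adopts \<open>tp\<close>. If some node has at least two
  products and no neighbours, it is free to adopt a product other than \<open>tp\<close>. Otherwise all
  singletons are \<open>{tp}\<close>, and as thresholds are positive, only \<open>tp\<close> can ever be adopted. The final
  nodes with value \<open>{tp}\<close> then form the least set that contains the nodes with a singleton and is
  closed under the adoption condition. A breadth-first search computes this set in time \<open>O(n\<^sup>2)\<close>:
  each node leaves the queue at most once, and then its weights are added to the accumulators of
  all nodes.
\<close>

section \<open>Reductions\<close>

text \<open>No product occurs here: once every singleton is known to be \<open>{tp}\<close>,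
  \<open>card (p i) < 2\<close> marks exactly the initial adopters of \<open>tp\<close>. The least
  such set is never constructed; that it is the whole graph is expressed by requiring all such sets
  to equal \<open>pverts G\<close>.\<close>

definition adoption_closed ::
  "'v pair_pre_digraph \<Rightarrow> ('v \<Rightarrow> 'v \<Rightarrow> real) \<Rightarrow> ('v \<Rightarrow> real) \<Rightarrow> ('v \<Rightarrow> 'a set) \<Rightarrow> 'v set \<Rightarrow> bool"
where
  "adoption_closed G w \<theta> p D \<longleftrightarrow>
     D \<subseteq> pverts G \<and> (\<forall>i\<in>pverts G. card (p i) < 2 \<longrightarrow> i \<in> D) \<and>
     (\<forall>i\<in>pverts G. \<theta> i \<le> (\<Sum>j\<in>neighbours G i \<inter> D. w j i) \<longrightarrow> i \<in> D)"

section \<open>Basic facts on networks, assignments and single reduction steps\<close>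

lemma social_networkD:
  assumes "social_network G w P \<theta> p"
  shows "finite (pverts G)" "finite P" "p \<in> assignments G P"
    "\<And>i. neighbours G i \<subseteq> pverts G" "\<And>i. finite (neighbours G i)"
    "\<And>i j. j \<in> neighbours G i \<Longrightarrow> 0 \<le> w j i"
    "\<And>i. i \<in> pverts G \<Longrightarrow> 0 < \<theta> i"
proof -
  from assms have "pair_digraph G" by (simp add: social_network_def)
  then interpret pair_digraph G .
  show fin: "finite (pverts G)" by simp
  show nb: "\<And>i. neighbours G i \<subseteq> pverts G"
    by (auto simp: neighbours_def dest: wellformed)
  show "\<And>i. finite (neighbours G i)"
    using nb fin by (rule finite_subset)
  show "finite P" "p \<in> assignments G P"
    "\<And>i j. j \<in> neighbours G i \<Longrightarrow> 0 \<le> w j i"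
    "\<And>i. i \<in> pverts G \<Longrightarrow> 0 < \<theta> i"
    using assms by (auto simp: social_network_def neighbours_def)
qed

lemma assignmentsD:
  assumes "p \<in> assignments G P" "finite P" "i \<in> pverts G"
  shows "p i \<subseteq> P" "finite (p i)" "p i \<noteq> {}"
  using assms by (auto simp: assignments_def PiE_def Pi_def intro: finite_subset)

lemma assignment_singletonI:
  assumes "p \<in> assignments G P" "finite P" "i \<in> pverts G" "card (p i) < 2" "t \<in> p i"
  shows "p i = {t}"
proof -
  have "card (p i) = 1"
    using assignmentsD[OF assms(1-3)] assms(4)
    by (metis One_nat_def card_gt_0_iff less_2_cases_iff less_irrefl)
  then show ?thesis using assms(5) by (auto simp: card_1_singleton_iff)
qed

lemma assignments_upd:
  assumes "q \<in> assignments G P" "i \<in> pverts G" "t \<in> q i"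
  shows "q(i := {t}) \<in> assignments G P"
  using assms by (auto simp: assignments_def PiE_def Pi_def extensional_def)

lemma reduces_upd:
  assumes "q \<in> assignments G P" "i \<in> pverts G" "card (q i) \<ge> 2" "t \<in> q i"
    "adoption_condition G w \<theta> q t i"
  shows "reduces G w P \<theta> q (q(i := {t}))"
proof -
  have "q i \<noteq> {t}" using assms(3) by auto
  then have "q(i := {t}) \<noteq> q" by (metis fun_upd_same)
  then show ?thesis using assms assignments_upd[OF assms(1,2,4)] by (auto simp: reduces_def)
qed

text \<open>A step changes only sets with at least two elements and leaves singletons behind, so
  each node changes at most once along a sequence.\<close>

lemma reduces_values:
  assumes "(reduces G w P \<theta>)\<^sup>*\<^sup>* p q" "p \<in> assignments G P"
  shows "q \<in> assignments G P \<and> (\<forall>i\<in>pverts G. q i = p i \<or> (\<exists>t\<in>p i. q i = {t}))"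
  using assms
proof (induction rule: rtranclp_induct)
  case (step q r)
  then show ?case unfolding reduces_def by fastforce
qed simp

lemma reduces_singleton:
  assumes "(reduces G w P \<theta>)\<^sup>*\<^sup>* p q" "p \<in> assignments G P" "i \<in> pverts G" "p i = {t}"
  shows "q i = {t}"
  using reduces_values[OF assms(1,2)] assms(3,4) by auto

text \<open>Termination measure: a changed node becomes a singleton and leaves the set of undecided
  nodes for good.\<close>

lemma reduces_decreasing:
  assumes "reduces G w P \<theta> p q" "finite (pverts G)"
  shows "{i\<in>pverts G. card (q i) \<ge> 2} \<subset> {i\<in>pverts G. card (p i) \<ge> 2}"
proof -
  have pq: "p \<in> assignments G P" "q \<in> assignments G P" "q \<noteq> p"
    and ch: "\<And>i. i \<in> pverts G \<Longrightarrow> q i \<noteq> p i \<Longrightarrow> card (p i) \<ge> 2 \<and> (\<exists>t. q i = {t})"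
    using assms(1) unfolding reduces_def by blast+
  \<comment> \<open>Assignments are extensional, so two different ones differ at some node.\<close>
  obtain i where i: "i \<in> pverts G" "q i \<noteq> p i"
    using pq unfolding assignments_def by (metis PiE_ext)
  have "card (q j) < 2" if "j \<in> pverts G" "q j \<noteq> p j" for j
    using ch[OF that] by auto
  then show ?thesis using i ch by (fastforce simp: not_less[symmetric])
qed

text \<open>Induction on the number of undecided nodes. This is what keeps
  \<open>unavoidable\<close> from holding vacuously.\<close>

lemma maximal_reduction_exists:
  assumes "finite (pverts G)"
  shows "\<exists>q. (reduces G w P \<theta>)\<^sup>*\<^sup>* p q \<and> \<not> (\<exists>r. reduces G w P \<theta> q r)"
proof (induction "card {i\<in>pverts G. card (p i) \<ge> 2}" arbitrary: p rule: less_induct)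
  case less
  show ?case
  proof (cases "\<exists>r. reduces G w P \<theta> p r")
    case True
    then obtain r where r: "reduces G w P \<theta> p r" by blast
    have "card {i\<in>pverts G. card (r i) \<ge> 2} < card {i\<in>pverts G. card (p i) \<ge> 2}"
      using assms by (intro psubset_card_mono reduces_decreasing[OF r]) auto
    from less[OF this] r show ?thesis by (meson converse_rtranclp_into_rtranclp)
  qed auto
qed

text \<open>Product sets only shrink, so \<open>tp\<close> must be present from the start. An
  undecided node without neighbours could irrevocably adopt another product in the first
  step.\<close>

lemma unavoidable_necessary:
  assumes sn: "social_network G w P \<theta> p"
    and un: "unavoidable G w P \<theta> p (const_assignment G tp)" and i: "i \<in> pverts G"
  shows "tp \<in> p i \<and> (card (p i) < 2 \<or> neighbours G i \<noteq> {})"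
proof -
  note sn' = social_networkD[OF sn]
  \<comment> \<open>Stated for every reachable \<open>r\<close>, because it is applied both to
    \<open>p\<close> and to the network after a wrong adoption.\<close>
  have max: "\<exists>q. (reduces G w P \<theta>)\<^sup>*\<^sup>* r q \<and> q i = {tp}" if "(reduces G w P \<theta>)\<^sup>*\<^sup>* p r" for r
  proof -
    obtain q where q: "(reduces G w P \<theta>)\<^sup>*\<^sup>* r q" "\<not> (\<exists>r. reduces G w P \<theta> q r)"
      using maximal_reduction_exists[OF sn'(1)] by blast
    with that un have "q = const_assignment G tp"
      unfolding unavoidable_def by (metis rtranclp_trans)
    with q i show ?thesis by (auto simp: const_assignment_def)
  qed
  have "tp \<in> p i" using max[of p] reduces_values[OF _ sn'(3)] i by fastforce
  moreover have False if c: "\<not> card (p i) < 2" and N: "neighbours G i = {}"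
  proof -
    have "\<not> p i \<subseteq> {tp}" using c card_mono[of "{tp}" "p i"] by auto
    then obtain t where t: "t \<in> p i" "t \<noteq> tp" by auto
    have "reduces G w P \<theta> p (p(i := {t}))"
      using c N t i sn'(3) by (intro reduces_upd) (auto simp: adoption_condition_def)
    then obtain q where q: "(reduces G w P \<theta>)\<^sup>*\<^sup>* (p(i := {t})) q" "q i = {tp}"
      using max[of "p(i := {t})"] by auto
    have "q i = {t}"
      by (rule reduces_singleton[OF q(1) assignments_upd[OF sn'(3) i t(1)] i]) simp
    with q t show False by simp
  qed
  ultimately show ?thesis by blast
qed

text \<open>Induction along the sequence: as long as all singletons are \<open>{tp}\<close> and sit
  in \<open>D\<close>, the weight that supports any adoption comes from \<open>D\<close>, so
  closedness puts the adopting node into \<open>D\<close> as well.\<close>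

lemma reduces_within_closed:
  assumes sn: "social_network G w P \<theta> p"
    and ok: "\<forall>i\<in>pverts G. tp \<in> p i \<and> (card (p i) < 2 \<or> neighbours G i \<noteq> {})"
    and D: "adoption_closed G w \<theta> p D"
    and red: "(reduces G w P \<theta>)\<^sup>*\<^sup>* p q"
  shows "\<forall>i\<in>pverts G. q i = p i \<or> i \<in> D \<and> q i = {tp}"
  using red
proof (induction rule: rtranclp_induct)
  case (step q r)
  note sn' = social_networkD[OF sn]
  \<comment> \<open>An unchanged singleton is covered by \<open>ok\<close> and the closedness of
    \<open>D\<close>, a changed one by the induction hypothesis.\<close>
  have single: "t = tp \<and> j \<in> D" if "j \<in> pverts G" "q j = {t}" for j t
  proof (cases "q j = p j")
    case True
    then have "card (p j) < 2"
      using that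
      by (metis is_singletonI is_singleton_altdef one_less_numeral_iff semiring_norm(76))
    then have "j \<in> D" using D that by (auto simp: adoption_closed_def)
    then show ?thesis using True ok that by auto
  qed (use step.IH that in auto)
  show ?case
  proof
    fix i assume i: "i \<in> pverts G"
    show "r i = p i \<or> i \<in> D \<and> r i = {tp}"
    proof (cases "r i = q i")
      case False
      with step.hyps(2) i obtain t where t: "card (q i) \<ge> 2" "t \<in> q i" "r i = {t}"
          "adoption_condition G w \<theta> q t i"
        unfolding reduces_def by blast
      \<comment> \<open>A changed node would already hold a singleton. As \<open>i\<close> is still
        undecided, \<open>ok\<close> gives it neighbours, which excludes the unconditional case of
        the adoption condition.\<close>
      then have "q i = p i" using step.IH i by force
      with t ok i have le: "\<theta> i \<le> (\<Sum>j\<in>{j \<in> neighbours G i. q j = {t}}. w j i)"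
        by (auto simp: adoption_condition_def)
      \<comment> \<open>Since the threshold is positive, an empty sum cannot reach it: some
        neighbour already holds \<open>{t}\<close>, which forces \<open>t = tp\<close>.\<close>
      with sn'(7)[OF i] have "{j \<in> neighbours G i. q j = {t}} \<noteq> {}" by force
      then have "t = tp" using single sn'(4) by blast
      have "{j \<in> neighbours G i. q j = {t}} \<subseteq> neighbours G i \<inter> D"
        using single sn'(4) by blast
      then have "(\<Sum>j\<in>{j \<in> neighbours G i. q j = {t}}. w j i) \<le> (\<Sum>j\<in>neighbours G i \<inter> D. w j i)"
        using sn'(5,6) by (intro sum_mono2) auto
      with le D i have "i \<in> D" by (auto simp: adoption_closed_def)
      with t \<open>t = tp\<close> show ?thesis by simp
    qed (use step.IH i in auto)
  qed
qed simp

text \<open>Left to right, a maximal sequence reaches the constant network although changes happen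
  only inside a given closed \<open>D\<close>. Right to left, the nodes with value
  \<open>{tp}\<close> in a maximal network form a closed set, hence all nodes.\<close>

lemma unavoidable_iff:
  assumes sn: "social_network G w P \<theta> p"
  shows "unavoidable G w P \<theta> p (const_assignment G tp) \<longleftrightarrow>
    (\<forall>i\<in>pverts G. tp \<in> p i \<and> (card (p i) < 2 \<or> neighbours G i \<noteq> {})) \<and>
    (\<forall>D. adoption_closed G w \<theta> p D \<longrightarrow> D = pverts G)" (is "?U \<longleftrightarrow> ?ok \<and> ?cl")
proof
  note sn' = social_networkD[OF sn]
  assume U: ?U
  then have ok: ?ok using unavoidable_necessary[OF sn] by blast
  have ?cl
  proof (intro allI impI)
    fix D assume D: "adoption_closed G w \<theta> p D"
    obtain q where q: "(reduces G w P \<theta>)\<^sup>*\<^sup>* p q" "\<not> (\<exists>r. reduces G w P \<theta> q r)"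
      using maximal_reduction_exists[OF sn'(1)] by blast
    with U have "q = const_assignment G tp" by (auto simp: unavoidable_def)
    then have qt: "q i = {tp}" if "i \<in> pverts G" for i
      using that by (simp add: const_assignment_def)
    have "i \<in> D" if i: "i \<in> pverts G" for i
    proof (cases "q i = p i")
      case True
      then have "card (p i) < 2"
        using qt[OF i]
        by (metis is_singletonI is_singleton_altdef one_less_numeral_iff semiring_norm(76))
      with D i show ?thesis by (auto simp: adoption_closed_def)
    qed (use reduces_within_closed[OF sn ok D q(1)] i in blast)
    with D show "D = pverts G" by (auto simp: adoption_closed_def)
  qed
  with ok show "?ok \<and> ?cl" by blast
next
  note sn' = social_networkD[OF sn]
  assume R: "?ok \<and> ?cl"
  then have ok: ?ok ..
  show ?U unfolding unavoidable_def
  proof (intro allI impI, elim conjE)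
    fix q assume q: "(reduces G w P \<theta>)\<^sup>*\<^sup>* p q" and mx: "\<not> (\<exists>r. reduces G w P \<theta> q r)"
    \<comment> \<open>With the trivially closed set of all nodes, the preceding lemma says that
      every value is either unchanged or \<open>{tp}\<close>.\<close>
    have "adoption_closed G w \<theta> p (pverts G)" by (simp add: adoption_closed_def)
    note vals = reduces_within_closed[OF sn ok this q]
    have qa: "q \<in> assignments G P" using reduces_values[OF q sn'(3)] by simp
    define D where "D = {i\<in>pverts G. q i = {tp}}"
    have base: "i \<in> D" if "i \<in> pverts G" "card (p i) < 2" for i
    proof -
      have "p i = {tp}" using assignment_singletonI[OF sn'(3,2) that] ok that by blast
      then show ?thesis using vals that by (auto simp: D_def)
    qed
    \<comment> \<open>Otherwise \<open>i\<close> would still be undecided and could adopt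
      \<open>tp\<close>, contradicting the maximality of \<open>q\<close>.\<close>
    have "i \<in> D" if i: "i \<in> pverts G" and le: "\<theta> i \<le> (\<Sum>j\<in>neighbours G i \<inter> D. w j i)" for i
    proof (rule ccontr)
      assume "i \<notin> D"
      then have "card (p i) \<ge> 2" "q i = p i"
        using base[of i] vals i by (auto simp: D_def not_less[symmetric])
      moreover have "neighbours G i \<inter> D = {j\<in>neighbours G i. q j = {tp}}"
        using sn'(4) by (auto simp: D_def)
      ultimately have "reduces G w P \<theta> q (q(i := {tp}))"
        using i le ok qa by (intro reduces_upd) (auto simp: adoption_condition_def)
      with mx show False by blast
    qed
    with base have "adoption_closed G w \<theta> p D" by (auto simp: adoption_closed_def D_def)
    with R have "D = pverts G" by blast
    then have "\<forall>i\<in>pverts G. q i = {tp}" by (auto simp: D_def)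
    moreover have "q \<in> extensional (pverts G)" using qa by (simp add: assignments_def PiE_def)
    ultimately show "const_assignment G tp = q"
      by (auto simp: const_assignment_def extensional_def fun_eq_iff)
  qed
qed

section \<open>Timed execution\<close>

text \<open>A total-correctness judgement with an upper bound on time, whereas \<open>exec\<close>
  counts steps exactly. Nesting \<open>runs\<close> inside \<open>Q\<close> makes it compose like a
  weakest precondition.\<close>

definition runs :: "com \<Rightarrow> state \<Rightarrow> nat \<Rightarrow> (state \<Rightarrow> bool) \<Rightarrow> bool" where
  "runs c s T Q \<longleftrightarrow> (\<exists>t s'. exec c s t s' \<and> t \<le> T \<and> Q s')"

section \<open>Straight-line programs: evaluation and cost\<close>

primrec loop_free :: "com \<Rightarrow> bool" where
  "loop_free Skip \<longleftrightarrow> True"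
| "loop_free (NAssign x e) \<longleftrightarrow> True"
| "loop_free (NStore a e1 e2 e) \<longleftrightarrow> True"
| "loop_free (RAssign x r) \<longleftrightarrow> True"
| "loop_free (RStore a e1 e2 r) \<longleftrightarrow> True"
| "loop_free (Seq c1 c2) \<longleftrightarrow> loop_free c1 \<and> loop_free c2"
| "loop_free (Cond b c1 c2) \<longleftrightarrow> loop_free c1 \<and> loop_free c2"
| "loop_free (While b c) \<longleftrightarrow> False"

text \<open>The worst case over both branches of a conditional. The value at \<open>While\<close> is
  a dummy, excluded by \<open>loop_free\<close>.\<close>

primrec cost :: "com \<Rightarrow> nat" where
  "cost Skip = 1"
| "cost (NAssign x e) = 1"
| "cost (NStore a e1 e2 e) = 1"
| "cost (RAssign x r) = 1"
| "cost (RStore a e1 e2 r) = 1"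
| "cost (Seq c1 c2) = cost c1 + cost c2"
| "cost (Cond b c1 c2) = Suc (max (cost c1) (cost c2))"
| "cost (While b c) = 0"

text \<open>A functional evaluator, so that the simplifier can compute final states. Its
  \<open>While\<close> clause is again a dummy.\<close>

primrec run :: "com \<Rightarrow> state \<Rightarrow> state" where
  "run Skip s = s"
| "run (NAssign x e) s = s\<lparr>nvar := (nvar s)(x := nval e s)\<rparr>"
| "run (NStore a e1 e2 e) s =
     s\<lparr>narr := store2 (narr s) a (nval e1 s) (nval e2 s) (nval e s)\<rparr>"
| "run (RAssign x r) s = s\<lparr>rvar := (rvar s)(x := rval r s)\<rparr>"
| "run (RStore a e1 e2 r) s =
     s\<lparr>rarr := store2 (rarr s) a (nval e1 s) (nval e2 s) (rval r s)\<rparr>"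
| "run (Seq c1 c2) s = run c2 (run c1 s)"
| "run (Cond b c1 c2) s = (if bval b s then run c1 s else run c2 s)"
| "run (While b c) s = s"

lemma exec_loop_free:
  "loop_free c \<Longrightarrow> \<exists>t. exec c s t (run c s) \<and> t \<le> cost c"
proof (induction c arbitrary: s)
  case (Seq c1 c2)
  obtain t1 where "exec c1 s t1 (run c1 s)" "t1 \<le> cost c1"
    using Seq.IH(1)[of s] Seq.prems by auto
  moreover obtain t2 where "exec c2 (run c1 s) t2 (run c2 (run c1 s))" "t2 \<le> cost c2"
    using Seq.IH(2)[of "run c1 s"] Seq.prems by auto
  ultimately show ?case
    by (intro exI[of _ "t1 + t2"]) (auto intro: exec.Seq)
next
  case (Cond b c1 c2)
  show ?case
  proof (cases "bval b s")
    case True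
    obtain t where "exec c1 s t (run c1 s)" "t \<le> cost c1"
      using Cond.IH(1)[of s] Cond.prems by auto
    with True show ?thesis by (intro exI[of _ "Suc t"]) (auto intro: exec.CondTrue)
  next
    case False
    obtain t where "exec c2 s t (run c2 s)" "t \<le> cost c2"
      using Cond.IH(2)[of s] Cond.prems by auto
    with False show ?thesis by (intro exI[of _ "Suc t"]) (auto intro: exec.CondFalse)
  qed
qed (auto intro: exec.intros)

lemma runs_loop_free:
  assumes "loop_free c" "cost c \<le> T" "Q (run c s)"
  shows "runs c s T Q"
  using exec_loop_free[OF assms(1)] assms(2,3) unfolding runs_def by (meson order_trans)

section \<open>Rules for sequencing and loops\<close>

lemma runs_Seq:
  assumes "runs c1 s T1 (\<lambda>s1. runs c2 s1 T2 Q)" "T1 + T2 \<le> T"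
  shows "runs (Seq c1 c2) s T Q"
proof -
  obtain t1 s1 t2 s2 where "exec c1 s t1 s1" "t1 \<le> T1" "exec c2 s1 t2 s2" "t2 \<le> T2" "Q s2"
    using assms(1) unfolding runs_def by blast
  then show ?thesis using assms(2) exec.Seq unfolding runs_def
    by (intro exI[of _ "t1 + t2"] exI[of _ s2]) auto
qed

text \<open>The strictly decreasing \<open>V\<close> bounds the number of iterations. Each costs at
  most \<open>B\<close> plus one step for the test; the leading 1 pays for the final failing
  test.\<close>

lemma runs_While_aux:
  fixes V :: "state \<Rightarrow> nat"
  assumes "\<And>s. I s \<Longrightarrow> bval b s \<Longrightarrow> runs c s B (\<lambda>s'. I s' \<and> V s' < V s)"
  shows "I s \<Longrightarrow> runs (While b c) s (1 + V s * (B + 1)) (\<lambda>s. I s \<and> \<not> bval b s)"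
proof (induction "V s" arbitrary: s rule: less_induct)
  case less
  show ?case
  proof (cases "bval b s")
    case True
    then obtain t1 s1 where 1: "exec c s t1 s1" "t1 \<le> B" "I s1" "V s1 < V s"
      using assms less.prems unfolding runs_def by blast
    then obtain t2 s2 where 2: "exec (While b c) s1 t2 s2" "t2 \<le> 1 + V s1 * (B + 1)"
        "I s2" "\<not> bval b s2"
      using less.hyps unfolding runs_def by blast
    \<comment> \<open>The unit by which \<open>V\<close> drops pays for the current
      iteration.\<close>
    have "(V s1 + 1) * (B + 1) \<le> V s * (B + 1)" using 1(4) by (intro mult_right_mono) auto
    then have "Suc (t1 + t2) \<le> 1 + V s * (B + 1)" using 1(2) 2(2) by simp
    with 1 2 True show ?thesis unfolding runs_def
      by (intro exI[of _ "Suc (t1 + t2)"] exI[of _ s2]) (auto intro: exec.WhileTrue)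
  next
    case False
    with less.prems show ?thesis unfolding runs_def
      by (intro exI[of _ 1] exI[of _ s]) (use exec.WhileFalse[of b s c] in auto)
  qed
qed

lemma runs_While:
  fixes V :: "state \<Rightarrow> nat"
  assumes "I s"
    and "\<And>s. I s \<Longrightarrow> bval b s \<Longrightarrow> runs c s B (\<lambda>s'. I s' \<and> V s' < V s)"
    and "1 + V s * (B + 1) \<le> T"
    and "\<And>s. I s \<Longrightarrow> \<not> bval b s \<Longrightarrow> Q s"
  shows "runs (While b c) s T Q"
  using runs_While_aux[where I = I, OF assms(2,1)] assms(3,4) unfolding runs_def
  by (meson order_trans)

lemma runs_mono:
  assumes "runs c s T Q" "\<And>s'. Q s' \<Longrightarrow> Q' s'"
  shows "runs c s T Q'"
  using assms unfolding runs_def by blast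

section \<open>The breadth-first search program\<close>

text \<open>\<open>mark\<close> is the membership table of the queue, which allows
  \<open>relax_body\<close> to test membership in one step.\<close>

definition enqueue :: com where
  "enqueue =
     Seq (NStore ''queue'' (NVar ''tail'') (NConst 0) (NVar ''i''))
    (Seq (NAssign ''tail'' (NAdd (NVar ''tail'') (NConst 1)))
         (NStore ''mark'' (NVar ''i'') (NConst 0) (NConst 1)))"

definition increment :: "name \<Rightarrow> com" where
  "increment x = NAssign x (NAdd (NVar x) (NConst 1))"

definition count_body :: com where
  "count_body =
     Seq (NAssign ''d'' (NAdd (NVar ''d'') (NArr ''edge'' (NVar ''j'') (NVar ''i''))))
         (increment ''j'')"

definition init_tail :: com where
  "init_tail =
     Seq (Cond (NLess (NArr ''card'' (NVar ''i'') (NConst 0)) (NConst 2))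
            enqueue
            (Cond (NLess (NVar ''d'') (NConst 1)) (NAssign ''result'' (NConst 0)) Skip))
    (Seq (Cond (NLess (NArr ''member'' (NVar ''i'') (NVar ''top'')) (NConst 1))
            (NAssign ''result'' (NConst 0)) Skip)
         (increment ''i''))"

definition init_body :: com where
  "init_body =
     Seq (Seq (NAssign ''d'' (NConst 0)) (NAssign ''j'' (NConst 0)))
    (Seq (While (NLess (NVar ''j'') (NVar ''n'')) count_body)
         init_tail)"

text \<open>No test for an arc from \<open>j\<close> to \<open>i\<close> is made: the weight matrix
  contains 0 where there is none.\<close>

definition relax_body :: com where
  "relax_body =
     Seq (RStore ''acc'' (NVar ''i'') (NConst 0)
            (RAdd (RArr ''acc'' (NVar ''i'') (NConst 0))
                  (RArr ''weight'' (NVar ''j'') (NVar ''i''))))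
    (Seq (Cond (BAnd (NLess (NArr ''mark'' (NVar ''i'') (NConst 0)) (NConst 1))
                     (BNot (RLess (RArr ''acc'' (NVar ''i'') (NConst 0))
                                  (RArr ''threshold'' (NVar ''i'') (NConst 0)))))
            enqueue Skip)
         (increment ''i''))"

definition spread_body :: com where
  "spread_body =
     Seq (Seq (NAssign ''j'' (NArr ''queue'' (NVar ''head'') (NConst 0)))
         (Seq (increment ''head'')
              (NAssign ''i'' (NConst 0))))
         (While (NLess (NVar ''i'') (NVar ''n'')) relax_body)"

text \<open>\<open>head\<close>, \<open>tail\<close>, \<open>mark\<close> and \<open>acc\<close>
  start from the zero-initialised memory. Entries are never removed from the queue array, so at the
  end \<open>tail\<close> counts all nodes reached.\<close>

definition spread :: com where
  "spread =
     Seq (Seq (NAssign ''result'' (NConst 1)) (NAssign ''i'' (NConst 0)))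
    (Seq (While (NLess (NVar ''i'') (NVar ''n'')) init_body)
    (Seq (While (NLess (NVar ''head'') (NVar ''tail'')) spread_body)
         (Cond (NLess (NVar ''tail'') (NVar ''n'')) (NAssign ''result'' (NConst 0)) Skip)))"

text \<open>The full history up to \<open>tail\<close>, including entries already processed; only
  the part from \<open>head\<close> on is pending.\<close>

definition queue :: "state \<Rightarrow> nat list" where
  "queue s = map (\<lambda>q. narr s ''queue'' q 0) [0..<nvar s ''tail'']"

lemma length_queue [simp]: "length (queue s) = nvar s ''tail''"
  by (simp add: queue_def)

lemma queue_cong:
  assumes "narr s' ''queue'' = narr s ''queue''" "nvar s' ''tail'' = nvar s ''tail''"
  shows "queue s' = queue s"
  using assms by (simp add: queue_def)

lemma queue_append:
  assumes "narr s' ''queue'' = store2 (narr s) ''queue'' (nvar s ''tail'') 0 x ''queue''"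
    and "nvar s' ''tail'' = Suc (nvar s ''tail'')"
  shows "queue s' = queue s @ [x]"
  using assms by (simp add: queue_def store2_def)

text \<open>The input cells are frozen, so that all invariants can refer to the initial state
  \<open>s0\<close>.\<close>

definition same_input :: "state \<Rightarrow> state \<Rightarrow> bool" where
  "same_input s0 s \<longleftrightarrow>
     nvar s ''n'' = nvar s0 ''n'' \<and> nvar s ''top'' = nvar s0 ''top'' \<and>
     narr s ''edge'' = narr s0 ''edge'' \<and> narr s ''member'' = narr s0 ''member'' \<and>
     narr s ''card'' = narr s0 ''card'' \<and>
     rarr s ''weight'' = rarr s0 ''weight'' \<and> rarr s ''threshold'' = rarr s0 ''threshold''"

text \<open>The counterpart of \<open>adoption_closed\<close> for indices and memory cells. Summing
  over all of \<open>D\<close> is right because absent arcs are stored with weight 0.\<close>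

definition index_closed :: "state \<Rightarrow> nat set \<Rightarrow> bool" where
  "index_closed s D \<longleftrightarrow>
     D \<subseteq> {..<nvar s ''n''} \<and> (\<forall>i<nvar s ''n''. narr s ''card'' i 0 < 2 \<longrightarrow> i \<in> D) \<and>
     (\<forall>i<nvar s ''n''. rarr s ''threshold'' i 0 \<le> (\<Sum>j\<in>D. rarr s ''weight'' j i) \<longrightarrow> i \<in> D)"

definition admissible :: "state \<Rightarrow> nat \<Rightarrow> bool" where
  "admissible s i \<longleftrightarrow> 0 < narr s ''member'' i (nvar s ''top'') \<and>
     (narr s ''card'' i 0 < 2 \<or> (\<exists>j<nvar s ''n''. 0 < narr s ''edge'' j i))"

definition init_inv :: "state \<Rightarrow> state \<Rightarrow> bool" where
  "init_inv s0 s \<longleftrightarrow>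
     same_input s0 s \<and> nvar s ''i'' \<le> nvar s0 ''n'' \<and>
     nvar s ''result'' = of_bool (\<forall>i<nvar s ''i''. admissible s0 i) \<and>
     queue s = filter (\<lambda>i. narr s0 ''card'' i 0 < 2) [0..<nvar s ''i''] \<and>
     (\<forall>i. narr s ''mark'' i 0 = of_bool (i \<in> set (queue s))) \<and>
     (\<forall>i. rarr s ''acc'' i 0 = 0) \<and> nvar s ''head'' = 0"

text \<open>Only the positivity of \<open>d\<close> is tracked: what matters is whether node
  \<open>k\<close> has a neighbour, not how many.\<close>

definition count_inv :: "state \<Rightarrow> nat \<Rightarrow> state \<Rightarrow> bool" where
  "count_inv s0 k s \<longleftrightarrow>
     init_inv s0 s \<and> nvar s ''i'' = k \<and> k < nvar s0 ''n'' \<and> nvar s ''j'' \<le> nvar s0 ''n'' \<and>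
     (0 < nvar s ''d'' \<longleftrightarrow> (\<exists>j<nvar s ''j''. 0 < narr s0 ''edge'' j k))"

text \<open>The last two conjuncts are the two halves of correctness: nodes outside the queue are
  below their threshold, and the queue lies in every closed set. The exact accumulator contents are
  kept apart, since they are out of step during relaxation.\<close>

definition spread_inv :: "state \<Rightarrow> state \<Rightarrow> bool" where
  "spread_inv s0 s \<longleftrightarrow>
     same_input s0 s \<and>
     nvar s ''result'' = of_bool (\<forall>i<nvar s0 ''n''. admissible s0 i) \<and>
     distinct (queue s) \<and> set (queue s) \<subseteq> {..<nvar s0 ''n''} \<and>
     (\<forall>i<nvar s0 ''n''. narr s0 ''card'' i 0 < 2 \<longrightarrow> i \<in> set (queue s)) \<and>
     nvar s ''head'' \<le> nvar s ''tail'' \<and>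
     (\<forall>i. narr s ''mark'' i 0 = of_bool (i \<in> set (queue s))) \<and>
     (\<forall>i<nvar s0 ''n''. i \<notin> set (queue s) \<longrightarrow> rarr s ''acc'' i 0 < rarr s0 ''threshold'' i 0) \<and>
     (\<forall>D. index_closed s0 D \<longrightarrow> set (queue s) \<subseteq> D)"

definition accumulated :: "state \<Rightarrow> state \<Rightarrow> nat \<Rightarrow> nat \<Rightarrow> bool" where
  "accumulated s0 s h i \<longleftrightarrow>
     rarr s ''acc'' i 0 = (\<Sum>j\<in>set (take h (queue s)). rarr s0 ''weight'' j i)"

text \<open>\<open>head\<close> is already advanced while entry \<open>h\<close> is being processed:
  indices below \<open>i\<close> have received its weight, the others have not.\<close>

definition relax_inv :: "state \<Rightarrow> nat \<Rightarrow> state \<Rightarrow> bool" where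
  "relax_inv s0 h s \<longleftrightarrow>
     spread_inv s0 s \<and> nvar s ''i'' \<le> nvar s0 ''n'' \<and> nvar s ''head'' = Suc h \<and>
     nvar s ''j'' = queue s ! h \<and>
     (\<forall>i<nvar s0 ''n''. accumulated s0 s (if i < nvar s ''i'' then Suc h else h) i)"

section \<open>Correctness and running time of the loops, from the inside out\<close>

lemma runs_count_loop:
  assumes "count_inv s0 k s" "nvar s ''j'' = 0"
  shows "runs (While (NLess (NVar ''j'') (NVar ''n'')) count_body) s (1 + 3 * nvar s0 ''n'')
    (\<lambda>s. count_inv s0 k s \<and> nvar s ''j'' = nvar s0 ''n'')"
proof (rule runs_While[where I = "count_inv s0 k" and B = 2
      and V = "\<lambda>s. nvar s0 ''n'' - nvar s ''j''"])
  fix s assume s: "count_inv s0 k s" "bval (NLess (NVar ''j'') (NVar ''n'')) s"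
  have q: "queue (run count_body s) = queue s"
    by (rule queue_cong) (simp_all add: count_body_def increment_def)
  show "runs count_body s 2 (\<lambda>s'. count_inv s0 k s' \<and>
      nvar s0 ''n'' - nvar s' ''j'' < nvar s0 ''n'' - nvar s ''j'')"
    using s q
    by (intro runs_loop_free)
      (auto simp: count_body_def increment_def count_inv_def init_inv_def same_input_def less_Suc_eq)
qed (use assms in \<open>auto simp: count_inv_def init_inv_def same_input_def\<close>)

text \<open>After the complete count, \<open>d\<close> tells whether \<open>k\<close> has
  neighbours, so the two conditionals decide \<open>admissible\<close>.\<close>

lemma runs_init_tail:
  assumes "count_inv s0 k s" "nvar s ''j'' = nvar s0 ''n''"
  shows "runs init_tail s 7 (\<lambda>s'. init_inv s0 s' \<and> nvar s' ''i'' = Suc k)"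
proof (rule runs_loop_free)
  let ?s = "run init_tail s"
  have *: "init_inv s0 s" "nvar s ''i'' = k" "k < nvar s0 ''n''"
    "0 < nvar s ''d'' \<longleftrightarrow> (\<exists>j<nvar s0 ''n''. 0 < narr s0 ''edge'' j k)" "same_input s0 s"
    using assms by (auto simp: count_inv_def init_inv_def)
  have q: "queue ?s = (if narr s0 ''card'' k 0 < 2 then queue s @ [k] else queue s)"
    using *(2,5)
    by (auto intro!: queue_append queue_cong
        simp: init_tail_def enqueue_def increment_def same_input_def store2_def)
  \<comment> \<open>\<open>result\<close> is only ever lowered to 0, and hence accumulates a
    conjunction.\<close>
  have "nvar ?s ''result'' = (if admissible s0 k then nvar s ''result'' else 0)"
    using *(2,4,5)
    by (auto simp: init_tail_def enqueue_def increment_def same_input_def store2_def admissible_def)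
  then have res: "nvar ?s ''result'' = of_bool (\<forall>i<Suc k. admissible s0 i)"
    using *(1,2) by (auto simp: init_inv_def less_Suc_eq)
  have mark: "narr ?s ''mark'' i 0 = of_bool (i \<in> set (queue ?s))" for i
    unfolding q using *(1,2,5)
    by (auto simp: init_tail_def enqueue_def increment_def same_input_def store2_def init_inv_def)
  have rest: "same_input s0 ?s" "nvar ?s ''i'' = Suc k" "rarr ?s ''acc'' = rarr s ''acc''"
    "nvar ?s ''head'' = nvar s ''head''"
    using *(2,5)
    by (auto simp: init_tail_def enqueue_def increment_def same_input_def store2_def)
  have "queue s = filter (\<lambda>i. narr s0 ''card'' i 0 < 2) [0..<k]"
    using *(1,2) by (simp add: init_inv_def)
  then have "queue ?s = filter (\<lambda>i. narr s0 ''card'' i 0 < 2) [0..<Suc k]"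
    unfolding q by simp
  then have "init_inv s0 ?s"
    unfolding init_inv_def rest res using rest(1) mark *(1,3) by (simp add: init_inv_def)
  with rest(2) show "init_inv s0 ?s \<and> nvar ?s ''i'' = Suc k" by blast
qed (simp_all add: init_tail_def enqueue_def increment_def)

lemma runs_init_body:
  assumes "init_inv s0 s" "nvar s ''i'' < nvar s0 ''n''"
  shows "runs init_body s (10 + 3 * nvar s0 ''n'')
    (\<lambda>s'. init_inv s0 s' \<and> nvar s' ''i'' = Suc (nvar s ''i''))"
  unfolding init_body_def
proof (rule runs_Seq[where ?T1.0 = 2 and ?T2.0 = "8 + 3 * nvar s0 ''n''", OF runs_loop_free])
  let ?c = "Seq (NAssign ''d'' (NConst 0)) (NAssign ''j'' (NConst 0))"
  have q: "queue (run ?c s) = queue s" by (rule queue_cong) simp_all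
  have "count_inv s0 (nvar s ''i'') (run ?c s)" "nvar (run ?c s) ''j'' = 0"
    using assms q by (auto simp: count_inv_def init_inv_def same_input_def)
  from runs_count_loop[OF this]
  show "runs (Seq (While (NLess (NVar ''j'') (NVar ''n'')) count_body) init_tail) (run ?c s)
    (8 + 3 * nvar s0 ''n'') (\<lambda>s'. init_inv s0 s' \<and> nvar s' ''i'' = Suc (nvar s ''i''))"
    by (intro runs_Seq[where ?T1.0 = "1 + 3 * nvar s0 ''n''" and ?T2.0 = 7])
      (auto elim!: runs_mono intro: runs_init_tail)
qed simp_all

lemma runs_init_loop:
  assumes "init_inv s0 s" "nvar s ''i'' = 0"
  shows "runs (While (NLess (NVar ''i'') (NVar ''n'')) init_body) s
    (1 + nvar s0 ''n'' * (11 + 3 * nvar s0 ''n''))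
    (\<lambda>s. init_inv s0 s \<and> nvar s ''i'' = nvar s0 ''n'')"
proof (rule runs_While[where I = "init_inv s0" and B = "10 + 3 * nvar s0 ''n''"
      and V = "\<lambda>s. nvar s0 ''n'' - nvar s ''i''"])
  fix s assume s: "init_inv s0 s" "bval (NLess (NVar ''i'') (NVar ''n'')) s"
  then have "nvar s ''i'' < nvar s0 ''n''" by (simp add: init_inv_def same_input_def)
  with runs_init_body[OF s(1) this]
  show "runs init_body s (10 + 3 * nvar s0 ''n'') (\<lambda>s'. init_inv s0 s' \<and>
      nvar s0 ''n'' - nvar s' ''i'' < nvar s0 ''n'' - nvar s ''i'')"
    by (auto elim!: runs_mono)
qed (use assms in \<open>auto simp: init_inv_def same_input_def\<close>)

text \<open>Enqueuing is sound because the accumulated weight comes from a part of the queue, which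
  lies in every closed set; nonnegative weights make the sum monotone. It is complete because an
  unmarked node is enqueued as soon as its threshold is reached.\<close>

lemma runs_relax_body:
  assumes inv: "relax_inv s0 h s" and i: "nvar s ''i'' < nvar s0 ''n''"
    and W: "\<And>i j. 0 \<le> rarr s0 ''weight'' i j"
  shows "runs relax_body s 6 (\<lambda>s'. relax_inv s0 h s' \<and> nvar s' ''i'' = Suc (nvar s ''i''))"
proof (rule runs_loop_free)
  let ?s = "run relax_body s"
  let ?i = "nvar s ''i''"
  let ?a = "rarr s ''acc'' ?i 0 + rarr s0 ''weight'' (nvar s ''j'') ?i"
  let ?new = "?i \<notin> set (queue s) \<and> rarr s0 ''threshold'' ?i 0 \<le> ?a"
  have sp: "spread_inv s0 s" and si: "same_input s0 s"
    and acc: "\<And>i. i < nvar s0 ''n'' \<Longrightarrow> accumulated s0 s (if i < ?i then Suc h else h) i"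
    and hd: "nvar s ''head'' = Suc h" "nvar s ''j'' = queue s ! h"
    and mark: "\<And>i. narr s ''mark'' i 0 = of_bool (i \<in> set (queue s))"
    using inv by (auto simp: relax_inv_def spread_inv_def)
  have h: "h < length (queue s)" using sp hd by (auto simp: spread_inv_def)
  have s': "same_input s0 ?s" "nvar ?s ''i'' = Suc ?i" "nvar ?s ''head'' = Suc h"
    "nvar ?s ''j'' = nvar s ''j''" "nvar ?s ''result'' = nvar s ''result''"
    and acc': "\<And>i. rarr ?s ''acc'' i 0 = (if i = ?i then ?a else rarr s ''acc'' i 0)"
    using si hd
    by (auto simp: relax_body_def enqueue_def increment_def same_input_def store2_def)
  have q: "queue ?s = (if ?new then queue s @ [?i] else queue s)"
    using si mark[of ?i]
    by (auto intro!: queue_append queue_cong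
        simp: relax_body_def enqueue_def increment_def same_input_def store2_def)
  have mark': "narr ?s ''mark'' i 0 = of_bool (i \<in> set (queue ?s))" for i
    unfolding q using si mark[of ?i] mark[of i]
    by (auto simp: relax_body_def enqueue_def increment_def same_input_def store2_def)
  \<comment> \<open>Appending happens behind position \<open>h\<close>, so the processed prefix is
    unaffected.\<close>
  have take: "take (Suc h) (queue ?s) = take (Suc h) (queue s)" "take h (queue ?s) = take h (queue s)"
    "queue ?s ! h = queue s ! h"
    using h by (auto simp: q nth_append)
  have dist: "distinct (queue s)" using sp by (simp add: spread_inv_def)
  have "set (take (Suc h) (queue s)) = insert (queue s ! h) (set (take h (queue s)))"
    using h by (simp add: take_Suc_conv_app_nth)
  \<comment> \<open>Distinctness of the queue ensures that the weight of entry \<open>h\<close> is a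
    new summand.\<close>
  moreover have "queue s ! h \<notin> set (take h (queue s))"
    using dist h by (auto simp: in_set_conv_nth nth_eq_iff_index_eq)
  ultimately have a: "?a = (\<Sum>j\<in>set (take (Suc h) (queue s)). rarr s0 ''weight'' j ?i)"
    using acc[OF i] hd by (simp add: accumulated_def)
  have sound: "?i \<in> D" if D: "index_closed s0 D" and new: ?new for D
  proof -
    have "set (take (Suc h) (queue s)) \<subseteq> D"
      using sp D by (meson set_take_subset spread_inv_def subset_trans)
    moreover have "finite D" using D finite_subset by (auto simp: index_closed_def)
    ultimately have "?a \<le> (\<Sum>j\<in>D. rarr s0 ''weight'' j ?i)"
      unfolding a using W by (intro sum_mono2) auto
    with new D i show ?thesis by (auto simp: index_closed_def)
  qed
  have "nvar ?s ''tail'' = length (queue ?s)" "nvar s ''tail'' = length (queue s)" by simp_all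
  then have tail: "nvar s ''tail'' \<le> nvar ?s ''tail''" by (simp only: q) simp
  have "spread_inv s0 ?s"
    unfolding spread_inv_def
  proof (intro conjI allI impI)
    show "distinct (queue ?s)" using dist by (simp add: q)
    show "set (queue ?s) \<subseteq> {..<nvar s0 ''n''}" using sp i by (auto simp: q spread_inv_def)
    show "i \<in> set (queue ?s)" if "i < nvar s0 ''n''" "narr s0 ''card'' i 0 < 2" for i
      using sp that by (auto simp: q spread_inv_def)
    show "nvar ?s ''head'' \<le> nvar ?s ''tail''"
      using sp tail s' hd by (auto simp: spread_inv_def)
    \<comment> \<open>Only the accumulator of \<open>?i\<close> has grown; if \<open>?i\<close> is
      still outside the queue, the threshold test has failed.\<close>
    show "rarr ?s ''acc'' i 0 < rarr s0 ''threshold'' i 0"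
      if "i < nvar s0 ''n''" "i \<notin> set (queue ?s)" for i
      using sp that by (auto simp: q acc' spread_inv_def split: if_splits)
    show "set (queue ?s) \<subseteq> D" if "index_closed s0 D" for D
      using sp sound that by (auto simp: q spread_inv_def)
  qed (use sp s' mark' in \<open>auto simp: spread_inv_def\<close>)
  moreover have "accumulated s0 ?s (if i < Suc ?i then Suc h else h) i" if "i < nvar s0 ''n''" for i
    using acc[OF that] a by (auto simp: accumulated_def acc' take less_Suc_eq)
  ultimately show "relax_inv s0 h ?s \<and> nvar ?s ''i'' = Suc ?i"
    using s' take hd i by (auto simp: relax_inv_def)
qed (simp_all add: relax_body_def enqueue_def increment_def)

lemma runs_relax_loop:
  assumes "relax_inv s0 h s" "nvar s ''i'' = 0"
    and W: "\<And>i j. 0 \<le> rarr s0 ''weight'' i j"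
  shows "runs (While (NLess (NVar ''i'') (NVar ''n'')) relax_body) s (1 + 7 * nvar s0 ''n'')
    (\<lambda>s. relax_inv s0 h s \<and> nvar s ''i'' = nvar s0 ''n'')"
proof (rule runs_While[where I = "relax_inv s0 h" and B = 6
      and V = "\<lambda>s. nvar s0 ''n'' - nvar s ''i''"])
  fix s assume s: "relax_inv s0 h s" "bval (NLess (NVar ''i'') (NVar ''n'')) s"
  then have "nvar s ''i'' < nvar s0 ''n''"
    by (simp add: relax_inv_def spread_inv_def same_input_def)
  with runs_relax_body[OF s(1) this W]
  show "runs relax_body s 6 (\<lambda>s'. relax_inv s0 h s' \<and>
      nvar s0 ''n'' - nvar s' ''i'' < nvar s0 ''n'' - nvar s ''i'')"
    by (auto elim!: runs_mono)
qed (use assms in \<open>auto simp: relax_inv_def spread_inv_def same_input_def\<close>)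

text \<open>At \<open>i = 0\<close> all accumulators reflect the first \<open>h\<close> entries, at
  \<open>i = n\<close> the first \<open>Suc h\<close>, which is the new \<open>head\<close>.\<close>

lemma runs_spread_body:
  assumes inv: "spread_inv s0 s" "\<forall>i<nvar s0 ''n''. accumulated s0 s (nvar s ''head'') i"
    and "nvar s ''head'' < nvar s ''tail''"
    and W: "\<And>i j. 0 \<le> rarr s0 ''weight'' i j"
  shows "runs spread_body s (4 + 7 * nvar s0 ''n'')
    (\<lambda>s'. spread_inv s0 s' \<and> (\<forall>i<nvar s0 ''n''. accumulated s0 s' (nvar s' ''head'') i) \<and>
          nvar s' ''head'' = Suc (nvar s ''head''))"
  unfolding spread_body_def
proof (rule runs_Seq[where ?T1.0 = 3 and ?T2.0 = "1 + 7 * nvar s0 ''n''", OF runs_loop_free])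
  let ?c = "Seq (NAssign ''j'' (NArr ''queue'' (NVar ''head'') (NConst 0)))
      (Seq (increment ''head'') (NAssign ''i'' (NConst 0)))"
  have q: "queue (run ?c s) = queue s" by (rule queue_cong) (simp_all add: increment_def)
  have "narr s ''queue'' (nvar s ''head'') 0 = queue s ! nvar s ''head''"
    using assms(3) by (simp add: queue_def)
  then have "relax_inv s0 (nvar s ''head'') (run ?c s)" "nvar (run ?c s) ''i'' = 0"
    using assms(1-3) q
    by (auto simp: relax_inv_def spread_inv_def accumulated_def same_input_def increment_def)
  from runs_relax_loop[OF this W]
  show "runs (While (NLess (NVar ''i'') (NVar ''n'')) relax_body) (run ?c s) (1 + 7 * nvar s0 ''n'')
    (\<lambda>s'. spread_inv s0 s' \<and> (\<forall>i<nvar s0 ''n''. accumulated s0 s' (nvar s' ''head'') i) \<and>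
          nvar s' ''head'' = Suc (nvar s ''head''))"
    by (rule runs_mono) (auto simp: relax_inv_def)
qed (simp_all add: increment_def)

lemma runs_spread_loop:
  assumes "spread_inv s0 s" "\<forall>i<nvar s0 ''n''. accumulated s0 s (nvar s ''head'') i"
    and W: "\<And>i j. 0 \<le> rarr s0 ''weight'' i j"
  shows "runs (While (NLess (NVar ''head'') (NVar ''tail'')) spread_body) s
    (1 + nvar s0 ''n'' * (5 + 7 * nvar s0 ''n''))
    (\<lambda>s. spread_inv s0 s \<and> (\<forall>i<nvar s0 ''n''. accumulated s0 s (nvar s ''head'') i) \<and>
         nvar s ''head'' = nvar s ''tail'')"
proof (rule runs_While[where B = "4 + 7 * nvar s0 ''n''"
      and I = "\<lambda>s. spread_inv s0 s \<and> (\<forall>i<nvar s0 ''n''. accumulated s0 s (nvar s ''head'') i)"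
      and V = "\<lambda>s. nvar s0 ''n'' - nvar s ''head''"])
  fix s
  assume inv: "spread_inv s0 s \<and> (\<forall>i<nvar s0 ''n''. accumulated s0 s (nvar s ''head'') i)"
    and "bval (NLess (NVar ''head'') (NVar ''tail'')) s"
  then have lt: "nvar s ''head'' < nvar s ''tail''" by simp
  \<comment> \<open>A distinct list of indices below \<open>n\<close> has at most \<open>n\<close>
    entries, so there are at most \<open>n\<close> iterations.\<close>
  have "length (queue s) \<le> nvar s0 ''n''"
    using inv unfolding spread_inv_def
    by (metis card_lessThan card_mono distinct_card finite_lessThan)
  with lt have "nvar s ''head'' < nvar s0 ''n''" by simp
  with runs_spread_body[OF _ _ lt W] inv
  show "runs spread_body s (4 + 7 * nvar s0 ''n'')
    (\<lambda>s'. (spread_inv s0 s' \<and> (\<forall>i<nvar s0 ''n''. accumulated s0 s' (nvar s' ''head'') i)) \<and>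
      nvar s0 ''n'' - nvar s' ''head'' < nvar s0 ''n'' - nvar s ''head'')"
    by (auto elim!: runs_mono)
qed (use assms in \<open>auto simp: spread_inv_def\<close>)

text \<open>When nothing is pending, the accumulators contain the weight of the whole queue. The
  queue is then closed, hence the least closed set, and \<open>tail\<close> is its
  cardinality.\<close>

lemma spread_result:
  assumes inv: "spread_inv s0 s" "\<forall>i<nvar s0 ''n''. accumulated s0 s (nvar s ''head'') i"
    and "nvar s ''head'' = nvar s ''tail''"
  shows "nvar s ''tail'' < nvar s0 ''n'' \<longleftrightarrow> (\<exists>D. index_closed s0 D \<and> D \<noteq> {..<nvar s0 ''n''})"
proof -
  have "take (nvar s ''head'') (queue s) = queue s" using assms(3) by simp
  with inv(2) have acc:
    "\<forall>i<nvar s0 ''n''. rarr s ''acc'' i 0 = (\<Sum>j\<in>set (queue s). rarr s0 ''weight'' j i)"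
    by (simp add: accumulated_def)
  have cl: "index_closed s0 (set (queue s))"
    unfolding index_closed_def
  proof (intro conjI allI impI)
    fix i assume i: "i < nvar s0 ''n''"
      and le: "rarr s0 ''threshold'' i 0 \<le> (\<Sum>j\<in>set (queue s). rarr s0 ''weight'' j i)"
    have "rarr s0 ''threshold'' i 0 \<le> rarr s ''acc'' i 0" using acc i le by simp
    with inv(1) i show "i \<in> set (queue s)" unfolding spread_inv_def by (meson not_le)
  qed (use inv(1) in \<open>simp_all add: spread_inv_def\<close>)
  have c: "card (set (queue s)) = nvar s ''tail''"
    using inv(1) by (simp add: spread_inv_def distinct_card)
  show ?thesis
  proof
    assume "nvar s ''tail'' < nvar s0 ''n''"
    with c have "set (queue s) \<noteq> {..<nvar s0 ''n''}" by (metis card_lessThan less_irrefl)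
    with cl show "\<exists>D. index_closed s0 D \<and> D \<noteq> {..<nvar s0 ''n''}" by blast
  next
    assume "\<exists>D. index_closed s0 D \<and> D \<noteq> {..<nvar s0 ''n''}"
    then obtain D where D: "index_closed s0 D" "D \<noteq> {..<nvar s0 ''n''}" by blast
    have "set (queue s) \<subseteq> D" using inv(1) D(1) unfolding spread_inv_def by blast
    moreover have "D \<subset> {..<nvar s0 ''n''}" using D unfolding index_closed_def by blast
    ultimately have "card (set (queue s)) < card {..<nvar s0 ''n''}"
      by (intro psubset_card_mono finite_lessThan) (rule subset_psubset_trans)
    with c show "nvar s ''tail'' < nvar s0 ''n''" by simp
  qed
qed

text \<open>The bound collects 2 steps of setup, the initialisation loop, the search loop and 2
  steps for the final test.\<close>

lemma runs_spread:
  assumes zero: "nvar s ''tail'' = 0" "nvar s ''head'' = 0"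
      "\<And>i. narr s ''mark'' i 0 = 0" "\<And>i. rarr s ''acc'' i 0 = 0"
    and W: "\<And>i j. 0 \<le> rarr s ''weight'' i j"
    and \<theta>: "\<And>i. i < nvar s ''n'' \<Longrightarrow> 0 < rarr s ''threshold'' i 0"
  shows "runs spread s (6 + 16 * nvar s ''n'' + 10 * nvar s ''n'' * nvar s ''n'')
    (\<lambda>s'. nvar s' ''result'' = of_bool ((\<forall>i<nvar s ''n''. admissible s i) \<and>
       (\<forall>D. index_closed s D \<longrightarrow> D = {..<nvar s ''n''})))" (is "runs _ _ _ ?Q")
proof -
  let ?n = "nvar s ''n''"
  let ?c = "Seq (NAssign ''result'' (NConst 1)) (NAssign ''i'' (NConst 0))"
  let ?final = "Cond (NLess (NVar ''tail'') (NVar ''n'')) (NAssign ''result'' (NConst 0)) Skip"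
  have init: "init_inv s (run ?c s)" "nvar (run ?c s) ''i'' = 0"
    using zero by (auto simp: init_inv_def same_input_def queue_def)
  \<comment> \<open>With \<open>head = 0\<close> the accumulators are empty sums, and positive
    thresholds put every node outside the queue below its threshold.\<close>
  have start: "spread_inv s s1 \<and> (\<forall>i<nvar s ''n''. accumulated s s1 (nvar s1 ''head'') i)"
    if "init_inv s s1" "nvar s1 ''i'' = ?n" for s1
    using that \<theta> by (auto simp: init_inv_def spread_inv_def accumulated_def index_closed_def)
  have final: "runs ?final s2 2 ?Q"
    if s2: "spread_inv s s2" "\<forall>i<?n. accumulated s s2 (nvar s2 ''head'') i"
      "nvar s2 ''head'' = nvar s2 ''tail''" for s2
    using spread_result[OF s2] s2(1)
    by (intro runs_loop_free) (auto simp: spread_inv_def same_input_def)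
  show ?thesis
    unfolding spread_def
  proof (rule runs_Seq[OF runs_loop_free])
    show "runs (Seq (While (NLess (NVar ''i'') (NVar ''n'')) init_body)
        (Seq (While (NLess (NVar ''head'') (NVar ''tail'')) spread_body) ?final))
      (run ?c s) ((1 + ?n * (11 + 3 * ?n)) + ((1 + ?n * (5 + 7 * ?n)) + 2)) ?Q"
    proof (rule runs_Seq[OF _ order_refl], rule runs_mono[OF runs_init_loop[OF init]], elim conjE)
      fix s1 assume s1: "init_inv s s1" "nvar s1 ''i'' = ?n"
      show "runs (Seq (While (NLess (NVar ''head'') (NVar ''tail'')) spread_body) ?final) s1
          ((1 + ?n * (5 + 7 * ?n)) + 2) ?Q"
      proof (rule runs_Seq[OF _ order_refl], rule runs_mono[OF runs_spread_loop])
        show "spread_inv s s1" "\<forall>i<?n. accumulated s s1 (nvar s1 ''head'') i"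
          using start[OF s1] by auto
      qed (use W final in blast)+
    qed
    show "cost ?c \<le> 2" by simp
    show "2 + ((1 + ?n * (11 + 3 * ?n)) + ((1 + ?n * (5 + 7 * ?n)) + 2))
        \<le> 6 + 16 * ?n + 10 * ?n * ?n"
      by (simp add: algebra_simps)
  qed simp
qed

section \<open>Correctness on encoded networks\<close>

lemma nth_image_lessThan: "(!) vs ` {..<length vs} = set vs"
  by (auto simp: set_conv_nth)

lemma nth_image_vimage:
  assumes "D \<subseteq> set vs"
  shows "(!) vs ` {i. i < length vs \<and> vs ! i \<in> D} = D"
  using assms by (auto simp: in_set_conv_nth subset_iff image_iff)

text \<open>Distinctness of \<open>vs\<close> makes indexing injective, so membership and sums can
  be moved between indices and nodes.\<close>

lemma encode_index_closed_iff:
  assumes sn: "social_network G w P \<theta> p" and vs: "enumerates vs (pverts G)"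
    and D: "D \<subseteq> {..<length vs}"
  shows "index_closed (encode G w \<theta> p vs ps k) D \<longleftrightarrow> adoption_closed G w \<theta> p ((!) vs ` D)"
proof -
  note sn' = social_networkD[OF sn]
  have dv: "distinct vs" "set vs = pverts G" using vs by (auto simp: enumerates_def)
  have inj: "inj_on ((!) vs) D" using dv(1) D by (auto intro!: inj_on_nth)
  have mem: "vs ! i \<in> (!) vs ` D \<longleftrightarrow> i \<in> D" if "i < length vs" for i
    using that dv(1) D by (auto simp: nth_eq_iff_index_eq subset_iff)
  \<comment> \<open>Non-neighbours contribute 0 by the encoding, so the sum restricts to neighbours
    after reindexing.\<close>
  have sum: "(\<Sum>j\<in>D. rarr (encode G w \<theta> p vs ps k) ''weight'' j i) =
      (\<Sum>v\<in>neighbours G (vs ! i) \<inter> (!) vs ` D. w v (vs ! i))" if i: "i < length vs" for i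
  proof -
    have "(\<Sum>j\<in>D. rarr (encode G w \<theta> p vs ps k) ''weight'' j i) =
        (\<Sum>j\<in>D. if vs ! j \<in> neighbours G (vs ! i) then w (vs ! j) (vs ! i) else 0)"
      using D i by (intro sum.cong) (auto simp: encode_def neighbours_def)
    also have "\<dots> = (\<Sum>v\<in>(!) vs ` D. if v \<in> neighbours G (vs ! i) then w v (vs ! i) else 0)"
      by (simp add: sum.reindex[OF inj])
    also have "\<dots> = (\<Sum>v\<in>neighbours G (vs ! i) \<inter> (!) vs ` D. w v (vs ! i))"
      using D finite_subset[of D] by (subst Int_commute) (simp add: sum.inter_restrict)
    finally show ?thesis .
  qed
  have ball: "(\<forall>v\<in>pverts G. R v) \<longleftrightarrow> (\<forall>i<length vs. R (vs ! i))" for R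
    by (simp flip: dv(2) add: all_set_conv_all_nth)
  have sub: "(!) vs ` D \<subseteq> pverts G" using D by (auto simp flip: dv(2) intro!: nth_mem)
  have [simp]: "nvar (encode G w \<theta> p vs ps k) ''n'' = length vs"
    "\<And>i. i < length vs \<Longrightarrow> narr (encode G w \<theta> p vs ps k) ''card'' i 0 = card (p (vs ! i))"
    "\<And>i. i < length vs \<Longrightarrow> rarr (encode G w \<theta> p vs ps k) ''threshold'' i 0 = \<theta> (vs ! i)"
    by (simp_all add: encode_def)
  show ?thesis
    using D sub by (simp add: index_closed_def adoption_closed_def ball mem sum)
qed

text \<open>Index sets and node sets correspond bijectively under image and preimage along
  \<open>vs\<close>.\<close>

lemma encode_closed_iff:
  assumes sn: "social_network G w P \<theta> p" and vs: "enumerates vs (pverts G)"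
  shows "(\<forall>D. index_closed (encode G w \<theta> p vs ps k) D \<longrightarrow> D = {..<length vs}) \<longleftrightarrow>
    (\<forall>D. adoption_closed G w \<theta> p D \<longrightarrow> D = pverts G)" (is "?L \<longleftrightarrow> ?R")
proof
  have dv: "distinct vs" "set vs = pverts G" using vs by (auto simp: enumerates_def)
  note iff = encode_index_closed_iff[OF sn vs]
  {
    assume L: ?L
    show ?R
    proof (intro allI impI)
      fix D assume D: "adoption_closed G w \<theta> p D"
      let ?D = "{i. i < length vs \<and> vs ! i \<in> D}"
      have im: "(!) vs ` ?D = D"
        using D dv(2) by (intro nth_image_vimage) (auto simp: adoption_closed_def)
      then have "index_closed (encode G w \<theta> p vs ps k) ?D" using iff[of ?D] D by auto
      with L have "?D = {..<length vs}" by blast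
      with im show "D = pverts G" using nth_image_lessThan[of vs] dv(2) by simp
    qed
  next
    assume R: ?R
    show ?L
    proof (intro allI impI)
      fix D assume D: "index_closed (encode G w \<theta> p vs ps k) D"
      then have sub: "D \<subseteq> {..<length vs}" by (simp add: index_closed_def encode_def)
      with D iff R have "(!) vs ` D = (!) vs ` {..<length vs}"
        using nth_image_lessThan[of vs] dv(2) by auto
      then show "D = {..<length vs}"
        using inj_on_image_eq_iff[OF inj_on_nth[OF dv(1)] sub order_refl] by auto
    qed
  }
qed

text \<open>Scanning the indices finds every neighbour, because arcs start at nodes of the graph and
  \<open>vs\<close> lists them all.\<close>

lemma encode_admissible_iff:
  assumes sn: "social_network G w P \<theta> p" and vs: "enumerates vs (pverts G)"
    and k: "k < length ps"
  shows "(\<forall>i<length vs. admissible (encode G w \<theta> p vs ps k) i) \<longleftrightarrow>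
    (\<forall>i\<in>pverts G. ps ! k \<in> p i \<and> (card (p i) < 2 \<or> neighbours G i \<noteq> {}))"
proof -
  have dv: "set vs = pverts G" using vs by (auto simp: enumerates_def)
  have "(\<exists>j<length vs. (vs ! j, v) \<in> parcs G) \<longleftrightarrow> neighbours G v \<noteq> {}" for v
  proof -
    have "(\<exists>j<length vs. (vs ! j, v) \<in> parcs G) \<longleftrightarrow> (\<exists>u\<in>set vs. (u, v) \<in> parcs G)"
      by (metis in_set_conv_nth)
    also have "\<dots> \<longleftrightarrow> neighbours G v \<noteq> {}"
      using social_networkD(4)[OF sn, of v] dv by (auto simp: neighbours_def)
    finally show ?thesis .
  qed
  then have "admissible (encode G w \<theta> p vs ps k) i \<longleftrightarrow>
      ps ! k \<in> p (vs ! i) \<and> (card (p (vs ! i)) < 2 \<or> neighbours G (vs ! i) \<noteq> {})"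
    if "i < length vs" for i
    using that k by (auto simp: admissible_def encode_def)
  then show ?thesis by (simp flip: dv add: all_set_conv_all_nth)
qed

theorem theorem5:
  shows "\<exists>(prog :: com) (T :: nat \<Rightarrow> nat).
    (\<lambda>n. real (T n)) \<in> O(\<lambda>n. real n ^ 2) \<and>
    (\<forall>(G :: 'v pair_pre_digraph) (w :: 'v \<Rightarrow> 'v \<Rightarrow> real) (P :: 'a set) (\<theta> :: 'v \<Rightarrow> real)
      (p :: 'v \<Rightarrow> 'a set) (tp :: 'a) (vs :: 'v list) (ps :: 'a list) (k :: nat).
      social_network G w P \<theta> p \<and> tp \<in> P \<and>
      enumerates vs (pverts G) \<and> enumerates ps P \<and> k < length ps \<and> ps ! k = tp \<longrightarrow>
      (\<exists>t s. exec prog (encode G w \<theta> p vs ps k) t s \<and>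
             t \<le> T (card (pverts G)) \<and>
             nvar s ''result'' =
               (if unavoidable G w P \<theta> p (const_assignment G tp) then 1 else 0)))"
proof (intro exI[of _ spread] exI[of _ "\<lambda>n. 6 + 16 * n + 10 * n * n"] conjI allI impI; (elim conjE)?)
  show "(\<lambda>n. real (6 + 16 * n + 10 * n * n)) \<in> O(\<lambda>n. real n ^ 2)"
  proof (rule bigoI[of _ 32], rule eventually_sequentiallyI[of 1])
    fix n :: nat assume "1 \<le> n"
    \<comment> \<open>The constant is 6 + 16 + 10: from \<open>n = 1\<close> on, 1 and
      \<open>n\<close> are both at most \<open>n * n\<close>.\<close>
    then have "6 + 16 * n + 10 * n * n \<le> 32 * n ^ 2"
      using mult_le_mono1[of 1 n n] unfolding power2_eq_square mult.assoc by linarith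
    then have "real (6 + 16 * n + 10 * n * n) \<le> real (32 * n ^ 2)" by (rule of_nat_mono)
    then show "norm (real (6 + 16 * n + 10 * n * n)) \<le> 32 * norm (real n ^ 2)" by simp
  qed
next
  fix G :: "'v pair_pre_digraph" and w \<theta> and P :: "'a set" and p tp vs and ps :: "'a list" and k
  assume sn: "social_network G w P \<theta> p" and vs: "enumerates vs (pverts G)"
    and k: "k < length ps" "ps ! k = tp"
  note sn' = social_networkD[OF sn]
  let ?s = "encode G w \<theta> p vs ps k"
  have dv: "distinct vs" "set vs = pverts G" using vs by (auto simp: enumerates_def)
  have n: "nvar ?s ''n'' = length vs" "card (pverts G) = length vs"
    using distinct_card[OF dv(1)] dv(2) by (simp_all add: encode_def)
  have "runs spread ?s (6 + 16 * nvar ?s ''n'' + 10 * nvar ?s ''n'' * nvar ?s ''n'')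
    (\<lambda>s'. nvar s' ''result'' = of_bool ((\<forall>i<nvar ?s ''n''. admissible ?s i) \<and>
       (\<forall>D. index_closed ?s D \<longrightarrow> D = {..<nvar ?s ''n''})))"
  proof (rule runs_spread)
    show "0 \<le> rarr ?s ''weight'' i j" for i j
      using sn'(6) by (auto simp: encode_def neighbours_def)
    show "0 < rarr ?s ''threshold'' i 0" if "i < nvar ?s ''n''" for i
      using sn'(7)[of "vs ! i"] nth_mem[of i vs] that dv(2) by (simp add: encode_def)
  qed (simp_all add: encode_def)
  then show "\<exists>t s. exec spread ?s t s \<and>
      t \<le> 6 + 16 * card (pverts G) + 10 * card (pverts G) * card (pverts G) \<and>
      nvar s ''result'' = (if unavoidable G w P \<theta> p (const_assignment G tp) then 1 else 0)"
    unfolding n encode_closed_iff[OF sn vs] encode_admissible_iff[OF sn vs k(1)]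
      k(2) unavoidable_iff[OF sn, symmetric] runs_def of_bool_def .
qed

end
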